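(* Let $\alpha\in(0,1)$, $r>0$, let $d\ge 1$ be an integer, and let $\phi\in C([-r,0];\mathbb{R}^d)$. Assume that $f:[0,\infty)\times\mathbb{R}^d\times\mathbb{R}^d\to\mathbb{R}^d$ is continuous and satisfies the following conditions: (i) there exists a positive constant $L$ such that $$\|f(t,x,y)-f(t,\hat x,\hat y)\|\le L\left(\|x-\hat x\|+\|y-\hat y\|\right)\qquad\text{for all } t\ge 0,\ x,y,\hat x,\hat y\in\mathbb{R}^d;$$ (ii) there exists a constant $\beta>2L$ (with $L$ as in (i)) such that $$\sup_{t\ge 0}\frac{\int_0^t (t-\tau)^{\alpha-1}\|f(\tau,0,0)\|\,d\tau}{E_\alpha(\beta t^\alpha)}<\infty .$$ Then the global solution $\varphi(\cdot,\phi)$ on $[-r,\infty)$ of the delay Caputo fractional initial condition problem $$\,^{C}D^{\alpha}_{0+}x(t)=f(t,x(t),x(t-r)),\quad t\ge 0,\qquad x(t)=\phi(t),\quad t\in[-r,0],$$ is exponentially bounded. More precisely, there exists a constant $C>0$ such that $$\|\varphi(t,\phi)\|\le C\,E_\alpha(\beta t^\alpha)\qquad\text{for all } t\ge 0 .$$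
   Context: $\mathbb{R}^d$ is equipped with a norm $\|\cdot\|$; $C(J;\mathbb{R}^d)$ is the space of continuous functions $J\to\mathbb{R}^d$. $E_\alpha(z)=\sum_{k=0}^\infty \frac{z^k}{\Gamma(\alpha k+1)}$, $z\in\mathbb{R}$, is the Mittag-Leffler function. For $\alpha\in(0,1)$, $^{C}D^{\alpha}_{0+}$ denotes the Caputo fractional derivative of order $\alpha$ with base point $0$, applied componentwise: $(^{C}D^{\alpha}_{0+}x)(t)=\frac{1}{\Gamma(1-\alpha)}\int_0^t (t-\tau)^{-\alpha}x'(\tau)\,d\tau$ for absolutely continuous $x$. A (global) solution of the initial condition problem on $[-r,\infty)$ is a function $\varphi\in C([-r,\infty);\mathbb{R}^d)$ satisfying the fractional equation on $[0,\infty)$ and $\varphi=\phi$ on $[-r,0]$. This is understood in the sense of the equivalent Volterra integral equation: $\varphi$ is a solution if and only if $\varphi(t)=\phi(t)$ for all $t\in[-r,0]$ and $$\varphi(t)=\phi(0)+\frac{1}{\Gamma(\alpha)}\int_0^t (t-\tau)^{\alpha-1}f(\tau,\varphi(\tau),\varphi(\tau-r))\,d\tau\quad\text{for all } t\ge 0.$$ Under condition (i) the problem has exactly one global solution on $[-r,\infty)$; it is denoted $\varphi(\cdot,\phi)$. A solution $\varphi(\cdot,\phi)$ is called exponentially bounded if there exist positive constants $C$ and $\lambda$ such that $\|\varphi(t,\phi)\|\le C\exp(\lambda t)$ for all $t\ge 0$. *)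

theory Defs
  imports "HOL-Analysis.Analysis"
begin

text \<open>
  The type class norm on \<^typ>\<open>real ^ 'd\<close> is the Euclidean one. An arbitrary norm on
  \<^typ>\<open>real ^ 'd\<close> is a function satisfying the norm axioms. Continuity always refers to the
  standard topology, which every norm on a finite-dimensional space induces.
\<close>

definition is_norm :: "('a::real_vector \<Rightarrow> real) \<Rightarrow> bool" where
  "is_norm N \<longleftrightarrow>
     (\<forall>x. 0 \<le> N x) \<and>
     (\<forall>x. N x = 0 \<longleftrightarrow> x = 0) \<and>
     (\<forall>c x. N (c *\<^sub>R x) = \<bar>c\<bar> * N x) \<and>
     (\<forall>x y. N (x + y) \<le> N x + N y)"

definition mittag_leffler :: "real \<Rightarrow> real \<Rightarrow> real" where
  "mittag_leffler \<alpha> z = (\<Sum>k. z ^ k / Gamma (\<alpha> * real k + 1))"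

text \<open>
  Abel kernel integral \<open>\<integral>\<^sub>0\<^sup>t (t - \<tau>)\<^sup>\<alpha>\<^sup>-\<^sup>1 g(\<tau>) d\<tau>\<close>. At \<open>\<tau> = t\<close> the
  kernel is \<open>0 powr (\<alpha> - 1) = 0\<close>, a null set. For \<open>\<alpha> > 0\<close> and \<open>g\<close> continuous on \<open>[0,t]\<close>
  the integrand is absolutely integrable, so this is also the Lebesgue integral.
\<close>

definition abel_integral :: "real \<Rightarrow> (real \<Rightarrow> 'a::euclidean_space) \<Rightarrow> real \<Rightarrow> 'a" where
  "abel_integral \<alpha> g t = integral {0..t} (\<lambda>\<tau>. ((t - \<tau>) powr (\<alpha> - 1)) *\<^sub>R g \<tau>)"

text \<open>
  Global solutions on \<open>[-r, \<infinity>)\<close> of the delay problem with Caputo derivative of order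
  \<open>\<alpha>\<close>, right-hand side \<open>f (t, x(t), x(t - r))\<close> and initial segment \<open>\<phi>\<close>, in the sense of the
  Volterra integral equation. The values of \<open>x\<close> below \<open>-r\<close> are irrelevant.
\<close>

definition caputo_delay_solution ::
  "real \<Rightarrow> real \<Rightarrow> (real \<Rightarrow> 'a \<Rightarrow> 'a \<Rightarrow> 'a) \<Rightarrow> (real \<Rightarrow> 'a) \<Rightarrow>
    (real \<Rightarrow> 'a::euclidean_space) \<Rightarrow> bool" where
  "caputo_delay_solution \<alpha> r f \<phi> x \<longleftrightarrow>
     continuous_on {-r..} x \<and>
     (\<forall>t\<in>{-r..0}. x t = \<phi> t) \<and>
     (\<forall>t\<ge>0. x t = \<phi> 0 +
        (1 / Gamma \<alpha>) *\<^sub>R abel_integral \<alpha> (\<lambda>\<tau>. f \<tau> (x \<tau>) (x (\<tau> - r))) t)"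

definition exponentially_bounded :: "('a \<Rightarrow> real) \<Rightarrow> (real \<Rightarrow> 'a) \<Rightarrow> bool" where
  "exponentially_bounded N x \<longleftrightarrow> (\<exists>C>0. \<exists>\<mu>>0. \<forall>t\<ge>0. N (x t) \<le> C * exp (\<mu> * t))"

end

theory Submission
  imports Defs
begin

text \<open>
  Put \<open>E t = E\<^sub>\<alpha>(\<beta> t\<^sup>\<alpha>)\<close>. Integrating the series termwise against the Abel kernel gives
  \<open>\<integral>\<^sub>0\<^sup>t (t - \<tau>)\<^sup>\<alpha>\<^sup>-\<^sup>1 E \<tau> d\<tau> \<le> \<Gamma>(\<alpha>)/\<beta> * E t\<close>. On \<open>[0, T]\<close> let \<open>q\<close> be the maximum of
  \<open>\<parallel>x t\<parallel> / E t\<close>, attained at \<open>s\<close>. Since \<open>E\<close> is increasing and at least 1, the delayed term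
  satisfies \<open>\<parallel>x (\<tau> - r)\<parallel> \<le> (P + q) * E \<tau>\<close> with \<open>P\<close> a bound for the initial segment. The Volterra
  equation at \<open>s\<close> then yields \<open>q \<le> A + (2L/\<beta>) q\<close> with \<open>A\<close> independent of \<open>T\<close>, and \<open>2L < \<beta>\<close>
  bounds \<open>q\<close>. The exponential bound on \<open>E\<close> comes from \<open>\<Gamma>(y + 1) \<ge> R\<^sup>y e\<^sup>-\<^sup>(\<^sup>R\<^sup>+\<^sup>1\<^sup>)\<close> (restrict
  Euler's integral to \<open>[R, R + 1]\<close>), choosing \<open>R\<close> proportional to \<open>t + 1\<close> so that the series is
  dominated by a geometric one.
\<close>

subsection \<open>The Mittag-Leffler function\<close>

lemma Gamma_ge_powr:
  fixes y R :: real
  assumes "0 \<le> y" "0 < R"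
  shows "R powr y * exp (-(R + 1)) \<le> Gamma (y + 1)"
proof -
  have "((\<lambda>_. R powr y * exp (-(R + 1))) has_integral (R powr y * exp (-(R + 1)))) {R..R+1}"
    using has_integral_const_real[of "R powr y * exp (-(R + 1))" R "R+1"] by simp
  \<comment> \<open>Extended by zero, the constant stays below Euler's integrand on the whole
    half-line, because that integrand is nonnegative.\<close>
  then have "((\<lambda>t. if t \<in> {R..R+1} then R powr y * exp (-(R + 1)) else 0)
      has_integral (R powr y * exp (-(R + 1)))) {0..}"
    using assms by (subst has_integral_restrict) auto
  moreover have "((\<lambda>t. t powr y / exp t) has_integral Gamma (y + 1)) {0..}"
    using Gamma_integral_real[of "y + 1"] assms by simp
  moreover have "R powr y * exp (-(R + 1)) \<le> t powr y / exp t" if "t \<in> {R..R+1}" for t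
  proof -
    have "R powr y * exp (-(R + 1)) \<le> t powr y * exp (-t)"
      using that assms by (intro mult_mono powr_mono2) auto
    then show ?thesis by (simp add: exp_minus field_simps)
  qed
  ultimately show ?thesis
    by (elim has_integral_le) auto
qed

lemma Gamma_mult_nat_add_1_pos:
  fixes \<alpha> :: real
  assumes "0 < \<alpha>"
  shows "0 < Gamma (\<alpha> * real k + 1)"
  using assms by (intro Gamma_real_pos add_nonneg_pos) auto

text \<open>The Gamma bound at y = \<alpha> k absorbs R^(\<alpha> k), and the factor 2 in the
  hypothesis leaves the geometric ratio 1/2. R stays free: any admissible R gives convergence, while
  one linear in t gives the exponential bound.\<close>

lemma mittag_leffler_term_le:
  fixes \<alpha> z R :: real
  assumes "0 < \<alpha>" "0 < R" "2 * \<bar>z\<bar> \<le> R powr \<alpha>"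
  shows "\<bar>z ^ k / Gamma (\<alpha> * real k + 1)\<bar> \<le> exp (R + 1) * (1 / 2) ^ k"
proof -
  note G = Gamma_mult_nat_add_1_pos[OF assms(1), of k]
  have "\<bar>z\<bar> ^ k \<le> (R powr \<alpha> / 2) ^ k"
    using assms by (intro power_mono) auto
  also have "\<dots> = R powr (\<alpha> * real k) * (1 / 2) ^ k"
    using assms by (simp add: power_divide powr_powr[symmetric] powr_realpow)
  also have "\<dots> \<le> (exp (R + 1) * Gamma (\<alpha> * real k + 1)) * (1 / 2) ^ k"
  proof (rule mult_right_mono)
    show "R powr (\<alpha> * real k) \<le> exp (R + 1) * Gamma (\<alpha> * real k + 1)"
      using Gamma_ge_powr[of "\<alpha> * real k" R] assms by (simp only: exp_minus) (simp add: field_simps)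
  qed simp
  finally show ?thesis
    using G by (simp add: abs_div abs_mult power_abs field_simps)
qed

lemma summable_mittag_leffler:
  fixes \<alpha> z :: real
  assumes "0 < \<alpha>"
  shows "summable (\<lambda>k. z ^ k / Gamma (\<alpha> * real k + 1))"
proof (rule summable_comparison_test')
  \<comment> \<open>The summand 1 keeps R positive when z = 0.\<close>
  define R where "R = (2 * \<bar>z\<bar> + 1) powr (1 / \<alpha>)"
  have R: "0 < R" "2 * \<bar>z\<bar> \<le> R powr \<alpha>"
    using assms by (auto simp: R_def powr_powr)
  show "summable (\<lambda>k. exp (R + 1) * (1 / 2 :: real) ^ k)"
    by (intro summable_mult summable_geometric) simp
  show "norm (z ^ k / Gamma (\<alpha> * real k + 1)) \<le> exp (R + 1) * (1 / 2) ^ k" if "0 \<le> k" for k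
    using mittag_leffler_term_le[OF assms R] by simp
qed

lemma mittag_leffler_le_exp:
  fixes \<alpha> z R :: real
  assumes "0 < \<alpha>" "0 < R" "2 * \<bar>z\<bar> \<le> R powr \<alpha>"
  shows "mittag_leffler \<alpha> z \<le> 2 * exp (R + 1)"
proof -
  have "mittag_leffler \<alpha> z \<le> (\<Sum>k. exp (R + 1) * (1 / 2) ^ k)"
    unfolding mittag_leffler_def
    using abs_le_D1[OF mittag_leffler_term_le[OF assms]]
    by (intro suminf_le summable_mittag_leffler summable_mult summable_geometric assms) auto
  also have "\<dots> = 2 * exp (R + 1)"
    by (subst suminf_mult) (auto simp: suminf_geometric)
  finally show ?thesis .
qed

lemma mittag_leffler_powr_le_exp:
  fixes \<alpha> \<beta> t :: real
  assumes "0 < \<alpha>" "0 < \<beta>" "0 \<le> t"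
  defines "c \<equiv> (2 * \<beta>) powr (1 / \<alpha>)"
  shows "mittag_leffler \<alpha> (\<beta> * t powr \<alpha>) \<le> 2 * exp (c + 1) * exp (c * t)"
proof -
  have c: "0 < c" "c powr \<alpha> = 2 * \<beta>"
    using assms by (auto simp: c_def powr_powr)
  \<comment> \<open>R = c (t + 1) is admissible because c^\<alpha> = 2 \<beta>; taking t + 1 rather
    than t keeps R positive at t = 0.\<close>
  have "mittag_leffler \<alpha> (\<beta> * t powr \<alpha>) \<le> 2 * exp (c * (t + 1) + 1)"
  proof (rule mittag_leffler_le_exp)
    show "2 * \<bar>\<beta> * t powr \<alpha>\<bar> \<le> (c * (t + 1)) powr \<alpha>"
      using assms c by (simp add: powr_mult abs_mult powr_mono2)
  qed (use assms c in auto)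
  then show ?thesis by (simp add: algebra_simps flip: exp_add)
qed

section \<open>Partial sums, monotonicity and continuity\<close>

lemma mittag_leffler_partial_sum_le:
  fixes \<alpha> z :: real
  assumes "0 < \<alpha>" "0 \<le> z"
  shows "(\<Sum>k<n. z ^ k / Gamma (\<alpha> * real k + 1)) \<le> mittag_leffler \<alpha> z"
  unfolding mittag_leffler_def using assms
  by (intro sum_le_suminf summable_mittag_leffler) (auto intro!: divide_nonneg_nonneg less_imp_le[OF Gamma_mult_nat_add_1_pos])

lemma mittag_leffler_ge_1:
  fixes \<alpha> z :: real
  assumes "0 < \<alpha>" "0 \<le> z"
  shows "1 \<le> mittag_leffler \<alpha> z"
  using mittag_leffler_partial_sum_le[OF assms, of 1] by simp

lemma mittag_leffler_mono:
  fixes \<alpha> y z :: real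
  assumes "0 < \<alpha>" "0 \<le> y" "y \<le> z"
  shows "mittag_leffler \<alpha> y \<le> mittag_leffler \<alpha> z"
  unfolding mittag_leffler_def using assms
  by (intro suminf_le summable_mittag_leffler divide_right_mono power_mono
      less_imp_le[OF Gamma_mult_nat_add_1_pos]) auto

text \<open>The remainder is again a series with positive coefficients. Its monotonicity supplies
  the uniform estimate needed to integrate the series termwise.\<close>

lemma mittag_leffler_tail_mono:
  fixes \<alpha> y z :: real
  assumes "0 < \<alpha>" "0 \<le> y" "y \<le> z"
  shows "mittag_leffler \<alpha> y - (\<Sum>k<n. y ^ k / Gamma (\<alpha> * real k + 1))
    \<le> mittag_leffler \<alpha> z - (\<Sum>k<n. z ^ k / Gamma (\<alpha> * real k + 1))"
  unfolding mittag_leffler_def using assms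
  unfolding suminf_minus_initial_segment[OF summable_mittag_leffler[OF assms(1)], symmetric]
  by (intro suminf_le summable_ignore_initial_segment summable_mittag_leffler
      divide_right_mono power_mono less_imp_le[OF Gamma_mult_nat_add_1_pos]) auto

lemma continuous_on_mittag_leffler_powr:
  fixes \<alpha> \<beta> :: real
  assumes "0 < \<alpha>"
  shows "continuous_on {0..} (\<lambda>t. mittag_leffler \<alpha> (\<beta> * t powr \<alpha>))"
proof -
  have "isCont (\<lambda>z. \<Sum>k. (1 / Gamma (\<alpha> * real k + 1)) * z ^ k) z" for z
    using summable_mittag_leffler[OF assms] by (intro isCont_powser_converges_everywhere) simp
  then have "continuous_on UNIV (mittag_leffler \<alpha>)"
    by (simp add: continuous_on_eq_continuous_at mittag_leffler_def[abs_def])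
  then show ?thesis
    by (rule continuous_on_compose2) (use assms in \<open>auto intro!: continuous_intros continuous_on_powr'\<close>)
qed

subsection \<open>Abel integrals\<close>

lemma abel_integrable:
  fixes g :: "real \<Rightarrow> 'a::euclidean_space"
  assumes "0 < \<alpha>" "continuous_on {0..t} g"
  shows "(\<lambda>\<tau>. ((t - \<tau>) powr (\<alpha> - 1)) *\<^sub>R g \<tau>) integrable_on {0..t}"
proof (cases "0 \<le> t")
  case True
  have "(\<lambda>\<tau>. \<tau> powr (\<alpha> - 1)) integrable_on (cbox 0 t)"
    using integrable_on_powr_from_0[of "\<alpha> - 1" t] assms True by simp
  \<comment> \<open>The reflection of \<tau> into t - \<tau> moves the singularity from 0 to
    t.\<close>
  from integrable_affinity[OF this, of "-1" t]
  have "(\<lambda>\<tau>. (t - \<tau>) powr (\<alpha> - 1)) integrable_on {0..t}" by simp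
  \<comment> \<open>Being nonnegative, the kernel is absolutely integrable, so its product with the
    bounded measurable g is integrable even if the kernel is unbounded near t.\<close>
  then have "(\<lambda>\<tau>. (t - \<tau>) powr (\<alpha> - 1)) absolutely_integrable_on {0..t}"
    by (rule nonnegative_absolutely_integrable_1) simp
  moreover have "bilinear (\<lambda>(v::'a) c::real. c *\<^sub>R v)"
    by (auto simp: bilinear_def linear_iff algebra_simps)
  moreover have "bounded (g ` {0..t})"
    by (intro compact_imp_bounded compact_continuous_image assms) auto
  ultimately show ?thesis
    using absolutely_integrable_bounded_measurable_product[of "\<lambda>v c. c *\<^sub>R v" g "{0..t}"]
      continuous_imp_measurable_on_sets_lebesgue[OF assms(2)]
    by (intro set_lebesgue_integral_eq_integral(1)) auto
qed (simp add: integrable_on_empty)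

lemma abel_integral_mono:
  fixes g h :: "real \<Rightarrow> real"
  assumes "0 < \<alpha>" "continuous_on {0..t} g" "continuous_on {0..t} h"
    and "\<And>\<tau>. \<tau> \<in> {0..t} \<Longrightarrow> g \<tau> \<le> h \<tau>"
  shows "abel_integral \<alpha> g t \<le> abel_integral \<alpha> h t"
  unfolding abel_integral_def using assms
  by (intro integral_le abel_integrable) (auto intro!: mult_left_mono)

lemma abel_integral_add:
  fixes g h :: "real \<Rightarrow> real"
  assumes "0 < \<alpha>" "continuous_on {0..t} g" "continuous_on {0..t} h"
  shows "abel_integral \<alpha> (\<lambda>\<tau>. g \<tau> + h \<tau>) t = abel_integral \<alpha> g t + abel_integral \<alpha> h t"
  unfolding abel_integral_def scaleR_add_right
  by (intro integral_add abel_integrable assms)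

lemma abel_integral_cmult:
  fixes g :: "real \<Rightarrow> real"
  shows "abel_integral \<alpha> (\<lambda>\<tau>. c * g \<tau>) t = c * abel_integral \<alpha> g t"
  by (simp add: abel_integral_def mult.left_commute)

lemma abel_integral_sum:
  fixes g :: "'i \<Rightarrow> real \<Rightarrow> real"
  assumes "0 < \<alpha>" "finite I" "\<And>i. i \<in> I \<Longrightarrow> continuous_on {0..t} (g i)"
  shows "abel_integral \<alpha> (\<lambda>\<tau>. \<Sum>i\<in>I. g i \<tau>) t = (\<Sum>i\<in>I. abel_integral \<alpha> (g i) t)"
  unfolding abel_integral_def scaleR_sum_right
  by (intro integral_sum abel_integrable assms)

text \<open>The substitution \<tau> = t s reduces the integral to the Beta function at (\<alpha> k +
  1, \<alpha>). The form \<open>(\<tau> powr \<alpha>) ^ k\<close> matches the terms of the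
  Mittag-Leffler series.\<close>

lemma abel_integral_powr_power:
  fixes \<alpha> t :: real
  assumes "0 < \<alpha>" "0 \<le> t"
  shows "abel_integral \<alpha> (\<lambda>\<tau>. (\<tau> powr \<alpha>) ^ k) t =
    Gamma \<alpha> * Gamma (\<alpha> * real k + 1) / Gamma (\<alpha> * real (Suc k) + 1) * (t powr \<alpha>) ^ Suc k"
proof (cases "t = 0")
  case True
  then show ?thesis using assms by (simp add: abel_integral_def)
next
  case False
  with assms have t: "0 < t" by simp
  define a where "a = \<alpha> * real k"
  have a: "0 \<le> a" using assms by (simp add: a_def)
  define B where "B = Gamma \<alpha> * Gamma (a + 1) / Gamma (\<alpha> * real (Suc k) + 1)"
  have "Beta (a + 1) \<alpha> = B"
    by (simp add: Beta_def B_def a_def algebra_simps)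
  then have "((\<lambda>s. s powr a * (1 - s) powr (\<alpha> - 1)) has_integral B) {0..1}"
    using has_integral_Beta_real[of "a + 1" \<alpha>] assms a by simp
  from has_integral_stretch_real[OF this, of "1 / t"] t
  have "((\<lambda>\<tau>. (\<tau> / t) powr a * (1 - \<tau> / t) powr (\<alpha> - 1)) has_integral t * B) {0..t}"
    by (simp add: image_mult_atLeastAtMost_if' mult.commute)
  then have *: "((\<lambda>\<tau>. t powr (a + \<alpha> - 1) * ((\<tau> / t) powr a * (1 - \<tau> / t) powr (\<alpha> - 1)))
    has_integral t powr (a + \<alpha> - 1) * (t * B)) {0..t}"
    by (rule has_integral_mult_right)
  have pow_eq: "(\<tau> powr \<alpha>) ^ k = \<tau> powr a" if "0 < \<tau>" for \<tau>
    using that by (simp add: a_def powr_powr[symmetric] powr_realpow del: powr_powr)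
  \<comment> \<open>The point 0 is left out because for k = 0 the two sides differ there:
    \<open>(0 powr \<alpha>) ^ 0\<close> is 1, but \<open>0 powr 0\<close> is 0.\<close>
  have eq: "(t - \<tau>) powr (\<alpha> - 1) *\<^sub>R (\<tau> powr \<alpha>) ^ k
    = t powr (a + \<alpha> - 1) * ((\<tau> / t) powr a * (1 - \<tau> / t) powr (\<alpha> - 1))"
    if "\<tau> \<in> {0..t} - {0}" for \<tau>
  proof -
    have "1 - \<tau> / t = (t - \<tau>) / t" using t by (simp add: field_simps)
    moreover have "t powr (a + \<alpha> - 1) = t powr a * t powr (\<alpha> - 1)"
      by (simp add: add_diff_eq flip: powr_add)
    ultimately show ?thesis
      using t that by (simp add: powr_divide pow_eq)
  qed
  have "((\<lambda>\<tau>. (t - \<tau>) powr (\<alpha> - 1) *\<^sub>R (\<tau> powr \<alpha>) ^ k)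
      has_integral t powr (a + \<alpha> - 1) * (t * B)) {0..t}"
    by (rule has_integral_spike[OF negligible_sing[of 0] eq *])
  moreover have "t powr (a + \<alpha> - 1) * (t * B) = B * (t powr \<alpha>) ^ Suc k"
    using t by (simp add: powr_diff powr_add pow_eq)
  ultimately have "abel_integral \<alpha> (\<lambda>\<tau>. (\<tau> powr \<alpha>) ^ k) t = B * (t powr \<alpha>) ^ Suc k"
    unfolding abel_integral_def by (simp only: integral_unique)
  then show ?thesis by (simp only: B_def a_def)
qed

text \<open>Integration cancels Gamma(\<alpha> k + 1) and turns term k into Gamma(\<alpha>)/\<beta>
  times term k + 1. The result is a shifted partial sum; the inequality comes from adding the
  missing constant term and the rest of the series.\<close>

lemma abel_integral_mittag_leffler_partial_sum_le:
  fixes \<alpha> \<beta> t :: real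
  assumes "0 < \<alpha>" "0 < \<beta>" "0 \<le> t"
  shows "abel_integral \<alpha> (\<lambda>\<tau>. \<Sum>k<n. (\<beta> * \<tau> powr \<alpha>) ^ k / Gamma (\<alpha> * real k + 1)) t
    \<le> Gamma \<alpha> / \<beta> * mittag_leffler \<alpha> (\<beta> * t powr \<alpha>)"
proof -
  note G = Gamma_mult_nat_add_1_pos[OF assms(1)]
  have cont: "continuous_on {0..t} (\<lambda>\<tau>. \<beta> ^ k / Gamma (\<alpha> * real k + 1) * (\<tau> powr \<alpha>) ^ k)" for k
    using assms G[of k] by (auto intro!: continuous_intros continuous_on_powr')
  have "abel_integral \<alpha> (\<lambda>\<tau>. \<Sum>k<n. (\<beta> * \<tau> powr \<alpha>) ^ k / Gamma (\<alpha> * real k + 1)) t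
    = abel_integral \<alpha> (\<lambda>\<tau>. \<Sum>k<n. \<beta> ^ k / Gamma (\<alpha> * real k + 1) * (\<tau> powr \<alpha>) ^ k) t"
    by (simp add: power_mult_distrib)
  also have "\<dots> = (\<Sum>k<n. \<beta> ^ k / Gamma (\<alpha> * real k + 1)
      * abel_integral \<alpha> (\<lambda>\<tau>. (\<tau> powr \<alpha>) ^ k) t)"
    using cont by (simp only: abel_integral_sum[OF assms(1) finite_lessThan] abel_integral_cmult)
  also have "\<dots> = (\<Sum>k<n. Gamma \<alpha> / \<beta> * ((\<beta> * t powr \<alpha>) ^ Suc k / Gamma (\<alpha> * real (Suc k) + 1)))"
    unfolding abel_integral_powr_power[OF assms(1,3)]
    using assms G by (intro sum.cong refl) (simp add: power_mult_distrib less_imp_neq[symmetric])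
  also have "\<dots> \<le> Gamma \<alpha> / \<beta> *
      (\<Sum>k<Suc n. (\<beta> * t powr \<alpha>) ^ k / Gamma (\<alpha> * real k + 1))"
    unfolding sum_distrib_left[symmetric] sum.lessThan_Suc_shift
    using assms by (intro mult_left_mono divide_nonneg_nonneg Gamma_real_nonneg) auto
  also have "\<dots> \<le> Gamma \<alpha> / \<beta> * mittag_leffler \<alpha> (\<beta> * t powr \<alpha>)"
    using assms by (intro mult_left_mono mittag_leffler_partial_sum_le divide_nonneg_nonneg
        Gamma_real_nonneg) auto
  finally show ?thesis .
qed

lemma abel_integral_mittag_leffler_le:
  fixes \<alpha> \<beta> t :: real
  assumes "0 < \<alpha>" "0 < \<beta>" "0 \<le> t"
  shows "abel_integral \<alpha> (\<lambda>\<tau>. mittag_leffler \<alpha> (\<beta> * \<tau> powr \<alpha>)) t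
    \<le> Gamma \<alpha> / \<beta> * mittag_leffler \<alpha> (\<beta> * t powr \<alpha>)"
proof -
  define S where "S n \<tau> = (\<Sum>k<n. (\<beta> * \<tau> powr \<alpha>) ^ k / Gamma (\<alpha> * real k + 1))" for n \<tau>
  define E where "E \<tau> = mittag_leffler \<alpha> (\<beta> * \<tau> powr \<alpha>)" for \<tau>
  have contE: "continuous_on {0..t} E"
    unfolding E_def by (rule continuous_on_subset[OF continuous_on_mittag_leffler_powr]) (use assms in auto)
  have contS: "continuous_on {0..t} (S n)" for n
    unfolding S_def using assms less_imp_neq[OF Gamma_mult_nat_add_1_pos[OF assms(1)], symmetric]
    by (intro continuous_intros continuous_on_powr') auto
  \<comment> \<open>The tail of the series is increasing, so its value at \<open>t\<close> bounds it uniformly on \<open>[0, t]\<close>.\<close>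
  have "abel_integral \<alpha> E t \<le> Gamma \<alpha> / \<beta> * E t + (E t - S n t) * abel_integral \<alpha> (\<lambda>_. 1) t" for n
  proof -
    have "abel_integral \<alpha> E t \<le> abel_integral \<alpha> (\<lambda>\<tau>. S n \<tau> + (E t - S n t) * 1) t"
    proof (rule abel_integral_mono)
      fix \<tau> assume "\<tau> \<in> {0..t}"
      then have "E \<tau> - S n \<tau> \<le> E t - S n t"
        unfolding E_def S_def using assms
        by (intro mittag_leffler_tail_mono mult_left_mono powr_mono2) auto
      then show "E \<tau> \<le> S n \<tau> + (E t - S n t) * 1" by simp
    qed (use assms contE contS in \<open>auto intro!: continuous_intros\<close>)
    also have "\<dots> = abel_integral \<alpha> (S n) t + (E t - S n t) * abel_integral \<alpha> (\<lambda>_. 1) t"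
      using contS assms by (simp only: abel_integral_add abel_integral_cmult continuous_on_const)
    finally show ?thesis
      using abel_integral_mittag_leffler_partial_sum_le[OF assms, of n, folded S_def E_def] by simp
  qed
  \<comment> \<open>The error is a fixed number times the remainder at t, so it vanishes as n
    grows.\<close>
  moreover have "(\<lambda>n. S n t) \<longlonglongrightarrow> E t"
    unfolding S_def E_def mittag_leffler_def
    by (intro summable_LIMSEQ summable_mittag_leffler assms)
  then have "(\<lambda>n. Gamma \<alpha> / \<beta> * E t + (E t - S n t) * abel_integral \<alpha> (\<lambda>_. 1) t)
      \<longlonglongrightarrow> Gamma \<alpha> / \<beta> * E t + (E t - E t) * abel_integral \<alpha> (\<lambda>_. 1) t"
    by (intro tendsto_intros)
  ultimately show ?thesis
    unfolding E_def[symmetric, abs_def] E_def[symmetric]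
    by (intro LIMSEQ_le_const[where X="\<lambda>n. Gamma \<alpha> / \<beta> * E t + (E t - S n t) * abel_integral \<alpha> (\<lambda>_. 1) t"])
      auto
qed


subsection \<open>Arbitrary norms on Euclidean spaces\<close>

locale finite_dim_norm =
  fixes N :: "'a::euclidean_space \<Rightarrow> real"
  assumes is_norm: "is_norm N"
begin

lemma nonneg: "0 \<le> N x"
  and zero: "N 0 = 0"
  and scale: "N (c *\<^sub>R x) = \<bar>c\<bar> * N x"
  and triangle: "N (x + y) \<le> N x + N y"
  using is_norm by (auto simp: is_norm_def)

lemma le_add_diff: "N x \<le> N y + N (x - y)"
  using triangle[of y "x - y"] by simp

lemma sum_le: "N (sum g I) \<le> (\<Sum>i\<in>I. N (g i))"
proof (induction I rule: infinite_finite_induct)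
  case (insert i I)
  then show ?case using triangle[of "g i" "sum g I"] by simp
qed (auto simp: zero)

lemma le_norm: "\<exists>B>0. \<forall>x. N x \<le> B * norm x"
proof (intro exI conjI allI)
  define B where "B = (\<Sum>b\<in>Basis. N b)"
  \<comment> \<open>Adding 1 makes the constant positive from the nonnegativity of B alone.\<close>
  show "0 < B + 1" by (simp add: B_def nonneg sum_nonneg add_nonneg_pos)
  fix x
  have "N x = N (\<Sum>b\<in>Basis. (x \<bullet> b) *\<^sub>R b)" by (simp add: euclidean_representation)
  also have "\<dots> \<le> (\<Sum>b\<in>Basis. \<bar>x \<bullet> b\<bar> * N b)"
    using sum_le[of "\<lambda>b. (x \<bullet> b) *\<^sub>R b" Basis] by (simp add: scale)
  also have "\<dots> \<le> (\<Sum>b\<in>Basis. norm x * N b)"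
    by (intro sum_mono mult_right_mono nonneg Basis_le_norm)
  also have "\<dots> \<le> (B + 1) * norm x" by (simp add: B_def sum_distrib_left algebra_simps)
  finally show "N x \<le> (B + 1) * norm x" .
qed

text \<open>The reverse triangle inequality and the comparison with the Euclidean norm make N
  Lipschitz.\<close>

lemma continuous_on_norm: "continuous_on S N"
proof -
  obtain B where B: "0 < B" "\<And>x. N x \<le> B * norm x" using le_norm by blast
  have "dist (N x) (N y) \<le> B * dist x y" for x y
    using le_add_diff[of x y] le_add_diff[of y x] B(2)[of "x - y"] B(2)[of "y - x"]
    by (simp add: dist_real_def dist_norm norm_minus_commute abs_le_iff)
  then have "B-lipschitz_on S N"
    using B(1) by (intro lipschitz_onI) auto
  then show ?thesis by (rule lipschitz_on_continuous_on)
qed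

text \<open>The library bounds only the Euclidean norm of an integral; for an arbitrary norm the
  inequality is inherited from Riemann sums.\<close>

lemma norm_has_integral_le:
  assumes g: "(g has_integral I) (cbox a b)" and h: "((\<lambda>x. N (g x)) has_integral J) (cbox a b)"
  shows "N I \<le> J"
proof (rule field_le_epsilon)
  fix e :: real assume "0 < e"
  obtain B where B: "0 < B" "\<And>x. N x \<le> B * norm x" using le_norm by blast
  \<comment> \<open>The Riemann sum for I contributes an error B d and the one for J an error d;
    together they make e.\<close>
  define d where "d = e / (B + 1)"
  have "0 < d" using \<open>0 < e\<close> B by (simp add: d_def)
  obtain \<gamma> where \<gamma>: "gauge \<gamma>" and
    g': "\<And>\<D>. \<D> tagged_division_of cbox a b \<Longrightarrow> \<gamma> fine \<D> \<Longrightarrow>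
      norm ((\<Sum>(x, k)\<in>\<D>. measure lborel k *\<^sub>R g x) - I) < d"
    using has_integralD[OF g \<open>0 < d\<close>] by blast
  obtain \<gamma>' where \<gamma>': "gauge \<gamma>'" and
    h': "\<And>\<D>. \<D> tagged_division_of cbox a b \<Longrightarrow> \<gamma>' fine \<D> \<Longrightarrow>
      norm ((\<Sum>(x, k)\<in>\<D>. measure lborel k *\<^sub>R N (g x)) - J) < d"
    using has_integralD[OF h \<open>0 < d\<close>] by blast
  \<comment> \<open>A common division is needed so that the triangle inequality can compare the two
    Riemann sums term by term.\<close>
  obtain \<D> where \<D>: "\<D> tagged_division_of cbox a b" "(\<lambda>x. \<gamma> x \<inter> \<gamma>' x) fine \<D>"
    using fine_division_exists[OF gauge_Int[OF \<gamma> \<gamma>']] .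
  then have fine: "\<gamma> fine \<D>" "\<gamma>' fine \<D>" by (simp_all add: fine_Int)
  define S where "S = (\<Sum>(x, k)\<in>\<D>. measure lborel k *\<^sub>R g x)"
  have "N I \<le> N S + N (I - S)" by (rule le_add_diff)
  also have "N (I - S) \<le> B * d"
  proof (rule order_trans[OF B(2)])
    show "B * norm (I - S) \<le> B * d"
      using g'[OF \<D>(1) fine(1)] B(1) by (simp add: S_def norm_minus_commute)
  qed
  also have "N S \<le> (\<Sum>(x, k)\<in>\<D>. measure lborel k *\<^sub>R N (g x))"
    unfolding S_def by (rule order_trans[OF sum_le]) (auto simp: scale intro!: sum_mono)
  also have "\<dots> \<le> J + d"
    using h'[OF \<D>(1) fine(2)] by (simp add: abs_less_iff)
  finally have "N I \<le> J + d + B * d"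
    by simp
  moreover have "(B + 1) * d = e"
    using B(1) by (simp add: d_def)
  ultimately show "N I \<le> J + e"
    by (simp add: algebra_simps)
qed

lemma abel_integral_le:
  assumes "0 < \<alpha>" "continuous_on {0..t} g"
  shows "N (abel_integral \<alpha> g t) \<le> abel_integral \<alpha> (\<lambda>\<tau>. N (g \<tau>)) t"
proof -
  have "continuous_on {0..t} (\<lambda>\<tau>. N (g \<tau>))"
    using continuous_on_compose2[OF continuous_on_norm assms(2)] by blast
  then have "((\<lambda>\<tau>. (t - \<tau>) powr (\<alpha> - 1) *\<^sub>R N (g \<tau>))
      has_integral abel_integral \<alpha> (\<lambda>\<tau>. N (g \<tau>)) t) (cbox 0 t)"
    unfolding abel_integral_def box_real by (intro integrable_integral abel_integrable assms)
  \<comment> \<open>The kernel is nonnegative, so homogeneity moves it inside N unchanged.\<close>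
  then have "((\<lambda>\<tau>. N ((t - \<tau>) powr (\<alpha> - 1) *\<^sub>R g \<tau>))
      has_integral abel_integral \<alpha> (\<lambda>\<tau>. N (g \<tau>)) t) (cbox 0 t)"
    by (simp add: scale)
  moreover have "((\<lambda>\<tau>. (t - \<tau>) powr (\<alpha> - 1) *\<^sub>R g \<tau>)
      has_integral abel_integral \<alpha> g t) (cbox 0 t)"
    unfolding abel_integral_def box_real by (intro integrable_integral abel_integrable assms)
  ultimately show ?thesis
    by (rule norm_has_integral_le[rotated])
qed

end

subsection \<open>Growth of the solution\<close>

theorem theorem4p1:
  fixes N :: "real ^ 'd \<Rightarrow> real"
    and f :: "real \<Rightarrow> real ^ 'd \<Rightarrow> real ^ 'd \<Rightarrow> real ^ 'd"
    and \<phi> x :: "real \<Rightarrow> real ^ 'd"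
    and \<alpha> r L \<beta> :: real
  assumes "is_norm N"
    and "0 < \<alpha>" and "\<alpha> < 1" and "0 < r"
    and "continuous_on {-r..0} \<phi>"
    and "continuous_on ({0..} \<times> UNIV \<times> UNIV) (\<lambda>(t, u, v). f t u v)"
    and "0 < L"
    and "\<And>t u v u' v'. 0 \<le> t \<Longrightarrow>
           N (f t u v - f t u' v') \<le> L * (N (u - u') + N (v - v'))"
    and "2 * L < \<beta>"
    and "(SUP t\<in>{0..}. ereal (abel_integral \<alpha> (\<lambda>\<tau>. N (f \<tau> 0 0)) t
           / mittag_leffler \<alpha> (\<beta> * t powr \<alpha>))) < \<infinity>"
    and "caputo_delay_solution \<alpha> r f \<phi> x"
  shows "exponentially_bounded N x \<and>
         (\<exists>C>0. \<forall>t\<ge>0. N (x t) \<le> C * mittag_leffler \<alpha> (\<beta> * t powr \<alpha>))"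
proof -
  interpret finite_dim_norm N by unfold_locales (rule assms)
  define E where "E t = mittag_leffler \<alpha> (\<beta> * t powr \<alpha>)" for t
  have \<beta>: "0 < \<beta>" using assms by simp
  have \<Gamma>: "0 < Gamma \<alpha>" using assms by simp
  have E_ge_1: "1 \<le> E t" for t
    unfolding E_def using assms(2) \<beta> by (intro mittag_leffler_ge_1) auto
  have E_pos: "0 < E t" for t using E_ge_1[of t] by linarith
  have E_mono: "E s \<le> E t" if "0 \<le> s" "s \<le> t" for s t
    unfolding E_def using that assms(2) \<beta>
    by (intro mittag_leffler_mono mult_left_mono powr_mono2) auto
  have E_cont: "continuous_on {0..t} E" for t
    unfolding E_def by (rule continuous_on_subset[OF continuous_on_mittag_leffler_powr])
      (use assms(2) in auto)
  have E_abel: "abel_integral \<alpha> E t \<le> Gamma \<alpha> / \<beta> * E t" if "0 \<le> t" for t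
    using abel_integral_mittag_leffler_le[OF assms(2) \<beta> that] unfolding E_def .
  have x_cont: "continuous_on {-r..} x"
    and x_eq: "\<And>t. 0 \<le> t \<Longrightarrow> x t = \<phi> 0 +
        (1 / Gamma \<alpha>) *\<^sub>R abel_integral \<alpha> (\<lambda>\<tau>. f \<tau> (x \<tau>) (x (\<tau> - r))) t"
    using assms(11) by (auto simp: caputo_delay_solution_def)
  have Nx_cont: "continuous_on S (\<lambda>t. N (x t))" if "S \<subseteq> {-r..}" for S
    using continuous_on_compose2[OF continuous_on_norm continuous_on_subset[OF x_cont that]] by blast
  have f_cont: "continuous_on {0..t} (\<lambda>\<tau>. f \<tau> (u \<tau>) (v \<tau>))"
    if "continuous_on {0..t} u" "continuous_on {0..t} v" for t u v
  proof -
    have "continuous_on {0..t} (\<lambda>\<tau>. (\<tau>, u \<tau>, v \<tau>))"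
      using that by (intro continuous_intros)
    then have "continuous_on {0..t} (\<lambda>\<tau>. case (\<tau>, u \<tau>, v \<tau>) of (t, u, v) \<Rightarrow> f t u v)"
      by (rule continuous_on_compose2[OF assms(6)]) auto
    then show ?thesis by simp
  qed
  have F_cont: "continuous_on {0..t} (\<lambda>\<tau>. f \<tau> (x \<tau>) (x (\<tau> - r)))" for t
    using assms(4) by (intro f_cont continuous_on_subset[OF x_cont]
        continuous_on_compose2[OF x_cont, of _ "\<lambda>\<tau>. \<tau> - r"] continuous_intros) auto
  have NF_cont: "continuous_on {0..t} (\<lambda>\<tau>. N (f \<tau> (x \<tau>) (x (\<tau> - r))))" for t
    using continuous_on_compose2[OF continuous_on_norm F_cont] by blast
  have N0_cont: "continuous_on {0..t} (\<lambda>\<tau>. N (f \<tau> 0 0))" for t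
    using continuous_on_compose2[OF continuous_on_norm f_cont[OF continuous_on_const continuous_on_const]]
    by blast
  obtain M where M: "\<And>t. 0 \<le> t \<Longrightarrow> abel_integral \<alpha> (\<lambda>\<tau>. N (f \<tau> 0 0)) t \<le> M * E t"
  proof -
    \<comment> \<open>A supremum below infinity lies strictly below some real M, which then bounds
      every quotient.\<close>
    from assms(10) obtain M where
      "(SUP t\<in>{0..}. ereal (abel_integral \<alpha> (\<lambda>\<tau>. N (f \<tau> 0 0)) t / E t)) < ereal M"
      unfolding E_def by (blast dest: ereal_dense2)
    then have "abel_integral \<alpha> (\<lambda>\<tau>. N (f \<tau> 0 0)) t / E t < M" if "0 \<le> t" for t
      using that by (auto dest: SUP_lessD)
    with that E_pos show ?thesis by (auto simp: pos_divide_less_eq intro: less_imp_le)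
  qed
  obtain P where P: "\<And>t. t \<in> {-r..0} \<Longrightarrow> N (x t) \<le> P"
    using continuous_attains_sup[OF compact_Icc _ Nx_cont, of "-r" 0] assms(4) by fastforce
  have "0 \<le> P" using P[of 0] nonneg[of "x 0"] assms(4) by auto
  \<comment> \<open>A collects the contributions free of q: the initial value, the initial segment
    seen through the delay, and f at the origin. C comes from solving q \<le> |A| + (2L/\<beta>) q
    for q, plus 1 for positivity. Both are fixed before T is chosen.\<close>
  define A where "A = N (\<phi> 0) + L * P / \<beta> + M / Gamma \<alpha>"
  define C where "C = \<bar>A\<bar> / (1 - 2 * L / \<beta>) + 1"
  have L\<beta>: "2 * L / \<beta> < 1" using assms(9) \<beta> by simp
  then have "0 < C" by (simp add: C_def add_nonneg_pos)
  have bound: "N (x T) \<le> C * E T" if "0 \<le> T" for T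
  proof -
    have "continuous_on {0..T} (\<lambda>t. N (x t) / E t)"
      using Nx_cont[of "{0..T}"] E_cont[of T] assms(4) E_pos less_imp_neq[OF E_pos, symmetric]
      by (intro continuous_on_divide) auto
    then obtain s where s: "s \<in> {0..T}" and
      s_max: "\<And>t. t \<in> {0..T} \<Longrightarrow> N (x t) / E t \<le> N (x s) / E s"
      using continuous_attains_sup[of "{0..T}" "\<lambda>t. N (x t) / E t"] \<open>0 \<le> T\<close> by auto
    define q where "q = N (x s) / E s"
    have "0 \<le> q" using nonneg E_pos[of s] by (simp add: q_def)
    have le_q: "N (x t) \<le> q * E t" if "0 \<le> t" "t \<le> T" for t
      using s_max[of t] that E_pos[of t] by (simp add: q_def pos_divide_le_eq)
    \<comment> \<open>For \<tau> \<le> r the delayed time lies in the initial segment, and otherwise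
      in [0, T]. The sum P + q covers both cases by one expression linear in q.\<close>
    have delay: "N (x (\<tau> - r)) \<le> (P + q) * E \<tau>" if \<tau>: "0 \<le> \<tau>" "\<tau> \<le> T" for \<tau>
    proof (cases "\<tau> \<le> r")
      case True
      then have "N (x (\<tau> - r)) \<le> P * 1" using P[of "\<tau> - r"] \<tau> by simp
      also have "\<dots> \<le> (P + q) * E \<tau>"
        using \<open>0 \<le> P\<close> \<open>0 \<le> q\<close> E_ge_1 by (intro mult_mono) auto
      finally show ?thesis .
    next
      case False
      then have "N (x (\<tau> - r)) \<le> q * E (\<tau> - r)" using \<tau> assms(4) by (intro le_q) auto
      also have "\<dots> \<le> (P + q) * E \<tau>"
        using \<open>0 \<le> P\<close> \<open>0 \<le> q\<close> False assms(4) less_imp_le[OF E_pos]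
        by (intro mult_mono E_mono) auto
      finally show ?thesis .
    qed
    \<comment> \<open>Comparing f with its value at the origin yields one q from the present state
      and one from the delayed state; hence the threshold 2L for \<beta>.\<close>
    have "N (f \<tau> (x \<tau>) (x (\<tau> - r))) \<le> L * (2 * q + P) * E \<tau> + N (f \<tau> 0 0)"
      if \<tau>: "\<tau> \<in> {0..s}" for \<tau>
    proof -
      have "N (f \<tau> (x \<tau>) (x (\<tau> - r))) \<le> N (f \<tau> 0 0) + L * (N (x \<tau>) + N (x (\<tau> - r)))"
        using le_add_diff[of "f \<tau> (x \<tau>) (x (\<tau> - r))" "f \<tau> 0 0"]
          assms(8)[of \<tau> "x \<tau>" "x (\<tau> - r)" 0 0] \<tau> by simp
      also have "L * (N (x \<tau>) + N (x (\<tau> - r))) \<le> L * (q * E \<tau> + (P + q) * E \<tau>)"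
        using le_q[of \<tau>] delay[of \<tau>] \<tau> s assms(7) by (intro mult_left_mono add_mono) auto
      finally show ?thesis by (simp add: algebra_simps)
    qed
    then have "abel_integral \<alpha> (\<lambda>\<tau>. N (f \<tau> (x \<tau>) (x (\<tau> - r)))) s
      \<le> abel_integral \<alpha> (\<lambda>\<tau>. L * (2 * q + P) * E \<tau> + N (f \<tau> 0 0)) s"
      using NF_cont N0_cont E_cont assms(2)
      by (intro abel_integral_mono continuous_intros) auto
    also have "\<dots> = L * (2 * q + P) * abel_integral \<alpha> E s + abel_integral \<alpha> (\<lambda>\<tau>. N (f \<tau> 0 0)) s"
      using N0_cont E_cont assms(2)
      by (subst abel_integral_add) (auto intro!: continuous_intros simp only: abel_integral_cmult)
    also have "\<dots> \<le> L * (2 * q + P) * (Gamma \<alpha> / \<beta> * E s) + M * E s"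
      using s assms(7) \<open>0 \<le> P\<close> \<open>0 \<le> q\<close> by (intro add_mono mult_left_mono E_abel M) auto
    finally have abel_le: "abel_integral \<alpha> (\<lambda>\<tau>. N (f \<tau> (x \<tau>) (x (\<tau> - r)))) s
      \<le> L * (2 * q + P) * (Gamma \<alpha> / \<beta> * E s) + M * E s" .
    have "q * E s = N (x s)" using E_pos[of s] by (simp add: q_def)
    also have "\<dots> \<le> N (\<phi> 0)
        + 1 / Gamma \<alpha> * N (abel_integral \<alpha> (\<lambda>\<tau>. f \<tau> (x \<tau>) (x (\<tau> - r))) s)"
      using s \<Gamma> triangle[of "\<phi> 0"
          "(1 / Gamma \<alpha>) *\<^sub>R abel_integral \<alpha> (\<lambda>\<tau>. f \<tau> (x \<tau>) (x (\<tau> - r))) s"]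
      by (simp add: x_eq[of s] scale)
    \<comment> \<open>Since E s is at least 1, the initial value is absorbed into a multiple of E s,
      which can then be divided out.\<close>
    also have "\<dots> \<le> N (\<phi> 0) * E s
        + 1 / Gamma \<alpha> * (L * (2 * q + P) * (Gamma \<alpha> / \<beta> * E s) + M * E s)"
      using \<Gamma> order_trans[OF abel_integral_le[OF assms(2) F_cont] abel_le] E_ge_1[of s] nonneg[of "\<phi> 0"]
        mult_left_mono[of 1 "E s" "N (\<phi> 0)"]
      by (intro add_mono mult_left_mono) auto
    also have "\<dots> = (A + 2 * L / \<beta> * q) * E s"
      using \<Gamma> \<beta> by (simp add: A_def field_simps)
    finally have "q \<le> A + 2 * L / \<beta> * q"
      using E_pos[of s] by simp
    \<comment> \<open>The absolute value makes the bound nonnegative whatever the sign of A.\<close>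
    then have "q * (1 - 2 * L / \<beta>) \<le> \<bar>A\<bar>" by (simp add: algebra_simps)
    then have "q \<le> C"
      unfolding C_def using L\<beta> by (simp add: pos_le_divide_eq add_increasing2)
    then have "q * E T \<le> C * E T" using E_pos[of T] by simp
    with le_q[of T] \<open>0 \<le> T\<close> show ?thesis by simp
  qed
  \<comment> \<open>This is the rate in \<open>mittag_leffler_powr_le_exp\<close>; it serves as the
    exponent in the exponential bound.\<close>
  define c where "c = (2 * \<beta>) powr (1 / \<alpha>)"
  have "N (x t) \<le> (C * (2 * exp (c + 1))) * exp (c * t)" if "0 \<le> t" for t
  proof -
    have "N (x t) \<le> C * E t" using that by (rule bound)
    also have "\<dots> \<le> C * (2 * exp (c + 1) * exp (c * t))"
      unfolding E_def c_def using that assms(2) \<beta> \<open>0 < C\<close>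
      by (intro mult_left_mono mittag_leffler_powr_le_exp) auto
    finally show ?thesis by (simp only: mult.assoc)
  qed
  moreover have "0 < c" "0 < C * (2 * exp (c + 1))" using \<beta> \<open>0 < C\<close> by (auto simp: c_def)
  ultimately have "exponentially_bounded N x"
    unfolding exponentially_bounded_def by blast
  with bound \<open>0 < C\<close> show ?thesis unfolding E_def by blast
qed

end
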